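(* Let $(X,p,E)$ be a lattice-normed vector lattice, where $(E,\|\cdot\|_E)$ is a Banach lattice, and let $(Y,m,F)$ be a lattice-normed space, where $(F,\|\cdot\|_F)$ is a $\sigma$-order continuous normed lattice. Let $T:X\to Y$ be a linear operator. If $T:(X,p,E)\to(Y,m,F)$ is sequentially $p$-continuous, then $T$ is norm continuous as an operator from the mixed-normed space $(X,p\text{-}\|\cdot\|_E)$ to the mixed-normed space $(Y,m\text{-}\|\cdot\|_F)$.
   Context: All vector lattices are real and Archimedean. A net $(x_\alpha)$ in a vector lattice $X$ order converges to $x$ (written $x_\alpha\xrightarrow{o}x$) if there is a net $(y_\beta)_{\beta\in B}$ (possibly with a different index set) with $y_\beta\downarrow 0$ such that for every $\beta$ there is $\alpha_\beta$ with $|x_\alpha-x|\le y_\beta$ for all $\alpha\ge\alpha_\beta$. A lattice-normed space (LNS) is a triple $(X,p,E)$ with $X$ a real vector space, $E$ a vector lattice and $p:X\to E_+$ such that $p(x)=0\Leftrightarrow x=0$, $p(\lambda x)=|\lambda|p(x)$, $p(x+y)\le p(x)+p(y)$. If moreover $X$ is a vector lattice and $|x|\le|y|$ implies $p(x)\le p(y)$, it is a lattice-normed vector lattice (LNVL). A net $x_\alpha$ $p$-converges to $x$ (written $x_\alpha\xrightarrow{p}x$) if $p(x_\alpha-x)\xrightarrow{o}0$ in $E$. A linear operator $T:(X,p,E)\to(Y,m,F)$ is sequentially $p$-continuous if $x_n\xrightarrow{p}0$ implies $Tx_n\xrightarrow{p}0$ for sequences $x_n$ in $X$. If $(E,\|\cdot\|_E)$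 is a normed lattice, the mixed norm on $X$ is $p\text{-}\|x\|_E=\|p(x)\|_E$; similarly $m\text{-}\|y\|_F=\|m(y)\|_F$. A normed lattice is $\sigma$-order continuous if every sequence $x_n$ order converging to $0$ (i.e. such that there is a net $(y_\beta)_{\beta\in B}$, possibly with a different index set, with $y_\beta\downarrow 0$ and for every $\beta$ there is $n_\beta$ with $|x_n|\le y_\beta$ for all $n\ge n_\beta$) converges to $0$ in norm. *)

theory Defs
  imports "HOL-Analysis.Analysis" "HOL-Library.Lattice_Algebras"
begin

class vector_lattice = ordered_real_vector + lattice_ab_group_add_abs

text \<open>The Archimedean property says that the infimum of \<open>x / n\<close> is \<open>0\<close> for every positive \<open>x\<close>.\<close>

class archimedean_vector_lattice = vector_lattice +
  assumes archimedean:
    "0 \<le> x \<Longrightarrow> (\<And>n::nat. z \<le> (1 / real (Suc n)) *\<^sub>R x) \<Longrightarrow> z \<le> 0"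

class normed_lattice = archimedean_vector_lattice + real_normed_vector +
  assumes norm_mono: "\<bar>x\<bar> \<le> \<bar>y\<bar> \<Longrightarrow> norm x \<le> norm y"

class banach_lattice = normed_lattice + banach

text \<open>A net has an index set \<open>A\<close> directed by a preorder \<open>r\<close>; only the values on \<open>A\<close> matter.\<close>

definition net_index :: "'i set \<Rightarrow> ('i \<Rightarrow> 'i \<Rightarrow> bool) \<Rightarrow> bool" where
  "net_index A r \<longleftrightarrow> A \<noteq> {} \<and> reflp_on A r \<and> transp_on A r \<and>
     (\<forall>\<alpha>\<in>A. \<forall>\<beta>\<in>A. \<exists>\<gamma>\<in>A. r \<alpha> \<gamma> \<and> r \<beta> \<gamma>)"

definition decreases_to ::
    "'i set \<Rightarrow> ('i \<Rightarrow> 'i \<Rightarrow> bool) \<Rightarrow> ('i \<Rightarrow> 'e::archimedean_vector_lattice) \<Rightarrow> 'e \<Rightarrow> bool" where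
  "decreases_to B r y l \<longleftrightarrow>
     (\<forall>\<beta>\<in>B. \<forall>\<gamma>\<in>B. r \<beta> \<gamma> \<longrightarrow> y \<gamma> \<le> y \<beta>) \<and>
     (\<forall>\<beta>\<in>B. l \<le> y \<beta>) \<and> (\<forall>z. (\<forall>\<beta>\<in>B. z \<le> y \<beta>) \<longrightarrow> z \<le> l)"

definition order_converges_wrt ::
    "'b set \<Rightarrow> ('b \<Rightarrow> 'b \<Rightarrow> bool) \<Rightarrow> ('b \<Rightarrow> 'e::archimedean_vector_lattice) \<Rightarrow>
     'i set \<Rightarrow> ('i \<Rightarrow> 'i \<Rightarrow> bool) \<Rightarrow> ('i \<Rightarrow> 'e) \<Rightarrow> 'e \<Rightarrow> bool" where
  "order_converges_wrt B s y A r x l \<longleftrightarrow>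
     net_index B s \<and> decreases_to B s y 0 \<and>
     (\<forall>\<beta>\<in>B. \<exists>\<alpha>\<^sub>0\<in>A. \<forall>\<alpha>\<in>A. r \<alpha>\<^sub>0 \<alpha> \<longrightarrow> \<bar>x \<alpha> - l\<bar> \<le> y \<beta>)"

text \<open>
  One cannot quantify over the type of the index set of the dominating net, so here that index set
  is a subset of \<open>'e\<close> with an arbitrary directed preorder. By \<open>order_convergesI\<close> below, index sets
  of every other type yield nothing more: a decreasing net may be replaced by its range.
\<close>

definition order_converges ::
    "'i set \<Rightarrow> ('i \<Rightarrow> 'i \<Rightarrow> bool) \<Rightarrow> ('i \<Rightarrow> 'e::archimedean_vector_lattice) \<Rightarrow> 'e \<Rightarrow> bool" where
  "order_converges A r x l \<longleftrightarrow>
     net_index A r \<and>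
     (\<exists>(B :: 'e set) s (y :: 'e \<Rightarrow> 'e). order_converges_wrt B s y A r x l)"

lemma order_convergesI:
  fixes B :: "'b set" and y :: "'b \<Rightarrow> 'e::archimedean_vector_lattice"
  assumes "net_index A r" and "order_converges_wrt B s y A r x l"
  shows "order_converges A r x l"
proof -
  have B: "B \<noteq> {}" "\<And>\<alpha> \<beta>. \<alpha> \<in> B \<Longrightarrow> \<beta> \<in> B \<Longrightarrow> \<exists>\<gamma>\<in>B. s \<alpha> \<gamma> \<and> s \<beta> \<gamma>"
    and y: "\<And>\<beta> \<gamma>. \<beta> \<in> B \<Longrightarrow> \<gamma> \<in> B \<Longrightarrow> s \<beta> \<gamma> \<Longrightarrow> y \<gamma> \<le> y \<beta>"
    using assms unfolding order_converges_wrt_def net_index_def decreases_to_def by blast+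
  have "\<exists>c\<in>y ` B. c \<le> a \<and> c \<le> b" if "a \<in> y ` B" "b \<in> y ` B" for a b
    using that B(2) y by (metis image_iff)
  then have "net_index (y ` B) (\<ge>)"
    using B(1) by (auto simp: net_index_def intro!: reflp_onI transp_onI)
  moreover have "decreases_to (y ` B) (\<ge>) (\<lambda>e. e) 0"
    using assms(2) by (auto simp: order_converges_wrt_def decreases_to_def)
  ultimately have "order_converges_wrt (y ` B) (\<ge>) (\<lambda>e. e) A r x l"
    using assms(2) by (auto simp: order_converges_wrt_def)
  then show ?thesis
    using assms(1) unfolding order_converges_def by blast
qed

definition sigma_order_continuous :: "'f::normed_lattice itself \<Rightarrow> bool" where
  "sigma_order_continuous _ \<longleftrightarrow>
     (\<forall>x :: nat \<Rightarrow> 'f. order_converges UNIV (\<le>) x 0 \<longrightarrow> x \<longlonglongrightarrow> 0)"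

definition lattice_normed_space ::
    "('x::real_vector \<Rightarrow> 'e::archimedean_vector_lattice) \<Rightarrow> bool" where
  "lattice_normed_space p \<longleftrightarrow>
     (\<forall>x. 0 \<le> p x) \<and> (\<forall>x. p x = 0 \<longleftrightarrow> x = 0) \<and>
     (\<forall>c x. p (c *\<^sub>R x) = \<bar>c\<bar> *\<^sub>R p x) \<and> (\<forall>x y. p (x + y) \<le> p x + p y)"

definition lattice_normed_vector_lattice ::
    "('x::archimedean_vector_lattice \<Rightarrow> 'e::archimedean_vector_lattice) \<Rightarrow> bool" where
  "lattice_normed_vector_lattice p \<longleftrightarrow>
     lattice_normed_space p \<and> (\<forall>x y. \<bar>x\<bar> \<le> \<bar>y\<bar> \<longrightarrow> p x \<le> p y)"

definition p_converges ::
    "('x::real_vector \<Rightarrow> 'e::archimedean_vector_lattice) \<Rightarrow>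
     'i set \<Rightarrow> ('i \<Rightarrow> 'i \<Rightarrow> bool) \<Rightarrow> ('i \<Rightarrow> 'x) \<Rightarrow> 'x \<Rightarrow> bool" where
  "p_converges p A r x l \<longleftrightarrow> order_converges A r (\<lambda>\<alpha>. p (x \<alpha> - l)) 0"

definition sequentially_p_continuous ::
    "('x::real_vector \<Rightarrow> 'e::archimedean_vector_lattice) \<Rightarrow>
     ('y::real_vector \<Rightarrow> 'f::archimedean_vector_lattice) \<Rightarrow> ('x \<Rightarrow> 'y) \<Rightarrow> bool" where
  "sequentially_p_continuous p m T \<longleftrightarrow>
     (\<forall>x :: nat \<Rightarrow> 'x. p_converges p UNIV (\<le>) x 0 \<longrightarrow> p_converges m UNIV (\<le>) (\<lambda>n. T (x n)) 0)"

definition mixed_norm :: "('x::real_vector \<Rightarrow> 'e::normed_lattice) \<Rightarrow> 'x \<Rightarrow> real" where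
  "mixed_norm p x = norm (p x)"

definition mixed_dist :: "('x::real_vector \<Rightarrow> 'e::normed_lattice) \<Rightarrow> 'x \<Rightarrow> 'x \<Rightarrow> real" where
  "mixed_dist p x y = mixed_norm p (x - y)"

lemma Metric_space_mixed_dist:
  assumes "lattice_normed_space p"
  shows "Metric_space UNIV (mixed_dist p)"
proof
  note p = assms[unfolded lattice_normed_space_def]
  fix x y z
  show "0 \<le> mixed_dist p x y"
    by (simp add: mixed_dist_def mixed_norm_def)
  have "p ((-1) *\<^sub>R (x - y)) = \<bar>-1\<bar> *\<^sub>R p (x - y)"
    using p by blast
  then show "mixed_dist p x y = mixed_dist p y x"
    by (simp add: mixed_dist_def mixed_norm_def)
  show "mixed_dist p x y = 0 \<longleftrightarrow> x = y"
    using p by (simp add: mixed_dist_def mixed_norm_def)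
  have "0 \<le> p (x - z)" and "p ((x - y) + (y - z)) \<le> p (x - y) + p (y - z)"
    using p by blast+
  then have "\<bar>p (x - z)\<bar> \<le> \<bar>p (x - y) + p (y - z)\<bar>"
    by simp
  then have "norm (p (x - z)) \<le> norm (p (x - y) + p (y - z))"
    by (rule norm_mono)
  also have "\<dots> \<le> norm (p (x - y)) + norm (p (y - z))"
    by (rule norm_triangle_ineq)
  finally show "mixed_dist p x z \<le> mixed_dist p x y + mixed_dist p y z"
    by (simp add: mixed_dist_def mixed_norm_def)
qed

definition mixed_topology :: "('x::real_vector \<Rightarrow> 'e::normed_lattice) \<Rightarrow> 'x topology" where
  "mixed_topology p = Metric_space.mtopology UNIV (mixed_dist p)"

end

theory Submission
  imports Defs
begin

text \<open>
  Otherwise some \<open>x n\<close> satisfy \<open>\<parallel>p (x n)\<parallel> \<le> 2\<^sup>-\<^sup>n / (n + 1)\<close> while \<open>\<parallel>m (T (x n))\<parallel>\<close> stays away from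
  \<open>0\<close>. By completeness \<open>e = \<Sum>n. (n + 1) p (x n)\<close> exists, and \<open>p (x n) \<le> e / (n + 1)\<close> shows that
  \<open>x n\<close> is \<open>p\<close>-null. Hence \<open>T (x n)\<close> is \<open>p\<close>-null, and \<open>\<sigma>\<close>-order continuity of the norm of \<open>F\<close> gives
  \<open>\<parallel>m (T (x n))\<parallel> \<longlongrightarrow> 0\<close>, a contradiction.
\<close>

text \<open>The positive cone is norm closed. For \<open>0 \<le> u n\<close> the triangle inequality
  bounds \<open>\<bar>l\<bar> - l\<close> by twice \<open>\<bar>l - u n\<bar>\<close>; the norm of
  this bound tends to \<open>0\<close>, which forces \<open>l = \<bar>l\<bar>\<close>.\<close>

lemma LIMSEQ_nonneg:
  fixes u :: "nat \<Rightarrow> 'e::normed_lattice"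
  assumes lim: "u \<longlonglongrightarrow> l" and ev: "\<forall>\<^sub>F n in sequentially. 0 \<le> u n"
  shows "0 \<le> l"
proof -
  have bound: "norm (\<bar>l\<bar> - l) \<le> norm (l - u n) + norm (l - u n)" if "0 \<le> u n" for n
  proof -
    have "\<bar>l\<bar> \<le> \<bar>l - u n\<bar> + \<bar>u n\<bar>"
      using abs_triangle_ineq[of "l - u n" "u n"] by simp
    also have "\<bar>u n\<bar> = (u n - l) + l"
      using that by simp
    also have "u n - l \<le> \<bar>l - u n\<bar>"
      using abs_ge_minus_self[of "l - u n"] by simp
    finally have "\<bar>l\<bar> - l \<le> \<bar>l - u n\<bar> + \<bar>l - u n\<bar>"
      by (simp add: algebra_simps)
    \<comment> \<open>Both sides are nonnegative, so the outer absolute values cost nothing; they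
      bring the inequality into the form that \<open>norm_mono\<close> compares.\<close>
    then have "\<bar>\<bar>l\<bar> - l\<bar> \<le> \<bar>\<bar>l - u n\<bar> + \<bar>l - u n\<bar>\<bar>"
      using abs_ge_self[of l] by simp
    then have "norm (\<bar>l\<bar> - l) \<le> norm (\<bar>l - u n\<bar> + \<bar>l - u n\<bar>)"
      by (rule norm_mono)
    also have "\<dots> \<le> norm \<bar>l - u n\<bar> + norm \<bar>l - u n\<bar>"
      by (rule norm_triangle_ineq)
    also have "norm \<bar>l - u n\<bar> \<le> norm (l - u n)"
      by (rule norm_mono) simp
    finally show ?thesis by simp
  qed
  have "(\<lambda>n. norm (l - u n) + norm (l - u n)) \<longlonglongrightarrow> norm (l - l) + norm (l - l)"
    by (intro tendsto_intros lim)
  then have "norm (\<bar>l\<bar> - l) \<le> norm (l - l) + norm (l - l)"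
    by (rule tendsto_lowerbound) (use ev bound in \<open>auto elim: eventually_mono\<close>)
  then have "l = \<bar>l\<bar>" by simp
  then show ?thesis
    by (metis abs_ge_zero)
qed

text \<open>Once \<open>k > n\<close>, the partial sum over \<open>{..<k}\<close> contains the term
  \<open>a n\<close>, so its difference with \<open>a n\<close> is nonnegative; closedness of the
  cone carries this over to the limit.\<close>

lemma le_suminf_of_nonneg:
  fixes a :: "nat \<Rightarrow> 'e::normed_lattice"
  assumes "summable a" and nonneg: "\<And>n. 0 \<le> a n"
  shows "a n \<le> suminf a"
proof -
  have "(\<lambda>k. sum a {..<k} - a n) \<longlonglongrightarrow> suminf a - a n"
    using assms(1) by (intro tendsto_intros summable_LIMSEQ)
  moreover have "\<forall>\<^sub>F k in sequentially. 0 \<le> sum a {..<k} - a n"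
    using eventually_gt_at_top[of n]
  proof eventually_elim
    case (elim k)
    then show ?case
      using nonneg sum_mono2[of "{..<k}" "{n}" a] by simp
  qed
  ultimately have "0 \<le> suminf a - a n"
    by (rule LIMSEQ_nonneg)
  then show ?thesis by simp
qed

text \<open>That the infimum is \<open>0\<close> is the Archimedean axiom. These multiples of
  \<open>e\<close> serve as the dominating net below.\<close>

lemma decreases_to_inverse_scaleR:
  fixes e :: "'e::archimedean_vector_lattice"
  assumes "0 \<le> e"
  shows "decreases_to UNIV (\<le>) (\<lambda>n::nat. (1 / real (Suc n)) *\<^sub>R e) 0"
  unfolding decreases_to_def
proof (intro conjI ballI impI allI)
  fix i j :: nat
  assume "i \<le> j"
  then show "(1 / real (Suc j)) *\<^sub>R e \<le> (1 / real (Suc i)) *\<^sub>R e"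
    using assms by (intro scaleR_right_mono) (simp_all add: frac_le)
next
  fix i :: nat
  show "0 \<le> (1 / real (Suc i)) *\<^sub>R e"
    using assms by (intro scaleR_nonneg_nonneg) simp_all
next
  fix z
  assume "\<forall>n\<in>UNIV. z \<le> (1 / real (Suc n)) *\<^sub>R e"
  then show "z \<le> 0"
    using archimedean[OF assms] by blast
qed

lemma order_converges_zero_of_small_norm:
  fixes u :: "nat \<Rightarrow> 'e::banach_lattice"
  assumes nonneg: "\<And>n. 0 \<le> u n" and small: "\<And>n. norm (u n) \<le> (1/2) ^ n / real (Suc n)"
  shows "order_converges UNIV (\<le>) u 0"
proof -
  define a where "a n = real (Suc n) *\<^sub>R u n" for n
  define e where "e = suminf a"
  have a_nonneg: "0 \<le> a n" for n
    unfolding a_def using nonneg by (intro scaleR_nonneg_nonneg) simp_all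
  have "norm (a n) \<le> (1/2) ^ n" for n
    using small[of n] by (simp add: a_def pos_le_divide_eq mult.commute del: of_nat_Suc)
  \<comment> \<open>Completeness of \<open>'e\<close> enters here: norms dominated by a geometric
    series give a convergent series.\<close>
  then have "summable a"
    by (intro summable_comparison_test'[OF summable_geometric[of "1/2 :: real"]]) simp_all
  then have a_le: "a n \<le> e" for n
    unfolding e_def by (rule le_suminf_of_nonneg) (rule a_nonneg)
  have u_le: "u n \<le> (1 / real (Suc n)) *\<^sub>R e" for n
  proof -
    have "u n = (1 / real (Suc n)) *\<^sub>R a n"
      by (simp add: a_def)
    also have "\<dots> \<le> (1 / real (Suc n)) *\<^sub>R e"
      by (intro scaleR_left_mono a_le) simp
    finally show ?thesis .
  qed
  have "0 \<le> e"
    using a_nonneg[of 0] a_le[of 0] by (rule order_trans)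
  then have decr: "decreases_to UNIV (\<le>) (\<lambda>n::nat. (1 / real (Suc n)) *\<^sub>R e) 0"
    by (rule decreases_to_inverse_scaleR)
  have net: "net_index UNIV ((\<le>) :: nat \<Rightarrow> nat \<Rightarrow> bool)"
    by (auto simp: net_index_def intro!: reflp_onI transp_onI intro: max.cobounded1 max.cobounded2)
  have "\<bar>u k - 0\<bar> \<le> (1 / real (Suc n)) *\<^sub>R e" if "n \<le> k" for n k
  proof -
    have "\<bar>u k - 0\<bar> = u k"
      using nonneg by simp
    also have "\<dots> \<le> (1 / real (Suc k)) *\<^sub>R e"
      by (rule u_le)
    also have "\<dots> \<le> (1 / real (Suc n)) *\<^sub>R e"
      using decr that unfolding decreases_to_def by blast
    finally show ?thesis .
  qed
  then have "order_converges_wrt UNIV (\<le>) (\<lambda>n::nat. (1 / real (Suc n)) *\<^sub>R e) UNIV (\<le>) u 0"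
    unfolding order_converges_wrt_def using net decr by blast
  \<comment> \<open>The dominating net is indexed by \<open>nat\<close>, while
    \<open>order_converges\<close> asks for an index set inside \<open>'e\<close>;
    \<open>order_convergesI\<close> passes to the range.\<close>
  with net show ?thesis
    by (rule order_convergesI)
qed

lemma mixed_norm_continuous_at_zero:
  fixes p :: "'x::real_vector \<Rightarrow> 'e::banach_lattice"
    and m :: "'y::real_vector \<Rightarrow> 'f::normed_lattice"
  assumes p: "lattice_normed_space p"
    and sigma: "sigma_order_continuous TYPE('f)"
    and cont: "sequentially_p_continuous p m T"
    and "0 < \<epsilon>"
  shows "\<exists>\<delta>>0. \<forall>x. mixed_norm p x < \<delta> \<longrightarrow> mixed_norm m (T x) < \<epsilon>"
proof (rule ccontr)
  assume neg: "\<not> ?thesis"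
  have "\<exists>x. norm (p x) < (1/2) ^ n / real (Suc n) \<and> \<not> norm (m (T x)) < \<epsilon>" for n
  proof -
    \<comment> \<open>This radius is tried as \<open>\<delta>\<close>; its failure yields the
      \<open>n\<close>-th term of the sequence.\<close>
    have "0 < (1/2 :: real) ^ n / real (Suc n)" by simp
    with neg show ?thesis
      unfolding mixed_norm_def by blast
  qed
  then obtain x where x: "\<And>n. norm (p (x n)) < (1/2) ^ n / real (Suc n)"
      and big: "\<And>n. \<not> norm (m (T (x n))) < \<epsilon>"
    by metis
  have "order_converges UNIV (\<le>) (\<lambda>n. p (x n)) 0"
    using p x by (intro order_converges_zero_of_small_norm)
      (auto simp: lattice_normed_space_def intro: less_imp_le)
  then have "p_converges m UNIV (\<le>) (\<lambda>n. T (x n)) 0"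
    using cont by (simp add: sequentially_p_continuous_def p_converges_def)
  then have "(\<lambda>n. m (T (x n))) \<longlonglongrightarrow> 0"
    using sigma by (simp add: sigma_order_continuous_def p_converges_def)
  then have "\<forall>\<^sub>F n in sequentially. norm (m (T (x n))) < \<epsilon>"
    using \<open>0 < \<epsilon>\<close> by (auto simp: tendsto_iff)
  with big show False by simp
qed

theorem proposition3:
  fixes p :: "'x::archimedean_vector_lattice \<Rightarrow> 'e::banach_lattice"
    and m :: "'y::real_vector \<Rightarrow> 'f::normed_lattice"
    and T :: "'x \<Rightarrow> 'y"
  assumes "lattice_normed_vector_lattice p"
    and "lattice_normed_space m"
    and "sigma_order_continuous TYPE('f)"
    and "linear T"
    and "sequentially_p_continuous p m T"
  shows "continuous_map (mixed_topology p) (mixed_topology m) T"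
proof -
  have p: "lattice_normed_space p"
    using assms(1) by (simp add: lattice_normed_vector_lattice_def)
  \<comment> \<open>Since \<open>T a - T x = T (a - x)\<close>, the \<open>\<delta>\<close> found at
    \<open>0\<close> works at every point \<open>a\<close>.\<close>
  have "\<exists>\<delta>>0. \<forall>x. mixed_dist p a x < \<delta> \<longrightarrow> mixed_dist m (T a) (T x) < \<epsilon>"
    if "0 < \<epsilon>" for a \<epsilon>
    using mixed_norm_continuous_at_zero[OF p assms(3,5) that]
    by (auto simp: mixed_dist_def simp flip: linear_diff[OF assms(4)])
  then show ?thesis
    unfolding mixed_topology_def
    using Metric_space.metric_continuous_map[OF Metric_space_mixed_dist[OF p]
        Metric_space_mixed_dist[OF assms(2)]]
    by simp
qed

end
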